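(* Let $A$ be an $m\times n$ matrix with integer entries, $n>m$, ${\rm rank}(A)=m$, columns ${\bf a}_1,\ldots,{\bf a}_n$, let ${\bf b}\in\mathbb{R}^m$, $P=\{{\bf x}\in\mathbb{R}^n:{\bf x}\geq0,\ A{\bf x}={\bf b}\}$, and let $X$ be the maximum-entropy random vector described in the context, with parameters $q_j$. Suppose that $n=pm$ for some integer $p$, that ${\bf a}_{(k-1)m+1},\ldots,{\bf a}_{km}$ are linearly independent for $1\leq k\leq p$, and that $\langle{\bf a}_j,{\bf b}\rangle>0$ for $1\leq j\leq n$. Define $q^\vee_i:=\min\{q_{(k-1)m+i}:1\leq k\leq p\}$ for $1\leq i\leq m$. Then there exist constants $C=C(q^\vee_1,\ldots,q^\vee_m)$ and $C'=C'(q^\vee_1,\ldots,q^\vee_m)$, with $C'<1$, such that $$|P\cap\mathbb{Z}^n|\ \leq\ e^{H(X)}\big(Cp^{-m/2}+(C')^p\big).$$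
   Context: $X=(X_1,\ldots,X_n)$ is the random vector with values in $\mathbb{Z}_{\geq 0}^n$ of maximum entropy subject to ${\bf E}[AX]={\bf b}$ (assumed to exist), with entropy $H(X)=-\sum_{{\bf k}}{\bf Pr}[X={\bf k}]\ln{\bf Pr}[X={\bf k}]$. Its coordinates are independent and geometrically distributed: ${\bf Pr}[X_j=k]=(1-q_j)q_j^k$ for $k\in\mathbb{Z}_{\geq0}$, with $q_j\in[0,1)$.
   Formalization: It is additionally assumed that every q^∨_i is positive; if some q^∨_i = 0, constants depending only on q^∨ need not exist (m=2, columns alternating between (1,0) and (1,1), b=(p,0), q^∨=(1/2,0)). *)

theory Defs
  imports "HOL-Probability.Probability" "Jordan_Normal_Form.DL_Rank"
begin

text \<open>Random vectors with values in $\mathbb{Z}_{\geq 0}^n$ are represented by their laws, of type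
  \<^typ>\<open>nat vec pmf\<close> with support in \<^term>\<open>carrier_vec n\<close>. Indices start at 0, so the $k$-th block of
  columns consists of the columns \<open>k * m + i\<close> with \<open>i < m\<close>, for \<open>k < p\<close>.\<close>

definition polyhedron_std :: "real mat \<Rightarrow> real vec \<Rightarrow> real vec set" where
  "polyhedron_std A b = {x \<in> carrier_vec (dim_col A). 0\<^sub>v (dim_col A) \<le> x \<and> A *\<^sub>v x = b}"

definition integer_vecs :: "nat \<Rightarrow> real vec set" where
  "integer_vecs n = {x \<in> carrier_vec n. \<forall>j<n. x $ j \<in> \<int>}"

text \<open>All summands are nonnegative, so the sum in \<^typ>\<open>ennreal\<close> always exists; the value \<open>\<infinity>\<close> is
  possible, and so maximality below is never decided by a junk value of a divergent real series.
  The convention $0 \ln 0 = 0$ is built in.\<close>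

definition pmf_entropy :: "'a pmf \<Rightarrow> ennreal" where
  "pmf_entropy X = (\<Sum>\<^sub>\<infinity>k. ennreal (- (pmf X k * ln (pmf X k))))"

definition mean_constrained :: "real mat \<Rightarrow> real vec \<Rightarrow> nat vec pmf set" where
  "mean_constrained A b = {X. set_pmf X \<subseteq> carrier_vec (dim_col A) \<and>
     (\<forall>i<dim_row A. integrable (measure_pmf X) (\<lambda>k. (A *\<^sub>v map_vec real k) $ i) \<and>
        measure_pmf.expectation X (\<lambda>k. (A *\<^sub>v map_vec real k) $ i) = b $ i)}"

definition max_entropy_vec :: "real mat \<Rightarrow> real vec \<Rightarrow> nat vec pmf \<Rightarrow> bool" where
  "max_entropy_vec A b X \<longleftrightarrow> X \<in> mean_constrained A b \<and>
     (\<forall>Y \<in> mean_constrained A b. pmf_entropy Y \<le> pmf_entropy X)"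

text \<open>The library's \<^term>\<open>geometric_pmf r\<close> gives $k \geq 0$ the mass $(1-r)^k r$, so $r = 1 - q_j$.\<close>

definition indep_geometric_coords :: "nat \<Rightarrow> nat vec pmf \<Rightarrow> (nat \<Rightarrow> real) \<Rightarrow> bool" where
  "indep_geometric_coords n X q \<longleftrightarrow>
     prob_space.indep_vars (measure_pmf X) (\<lambda>_. count_space UNIV) (\<lambda>j k. k $ j) {..<n} \<and>
     (\<forall>j<n. 0 \<le> q j \<and> q j < 1 \<and> map_pmf (\<lambda>k. k $ j) X = geometric_pmf (1 - q j))"

text \<open>Library linear independence is a property of sets; injectivity makes it one of the family
  of columns, ruling out repeated ones.\<close>

definition indep_columns :: "real mat \<Rightarrow> nat set \<Rightarrow> bool" where
  "indep_columns A J \<longleftrightarrow> inj_on (col A) J \<and>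
     module.lin_indpt class_ring (module_vec TYPE(real) (dim_row A)) (col A ` J)"

text \<open>Bounds uniform over all instances with a given vector of minima need all its entries to be
  positive. For $m = 2$, columns alternating between $(1,0)$ and $(1,1)$, and $b = (p,0)$, the minima
  are $(1/2, 0)$, $e^{H(X)} = 4^p$, and the number of integer points is ${2p-1 \choose p}$, which
  is of order $4^p p^{-1/2}$ rather than $4^p p^{-m/2}$.\<close>

definition qvee :: "nat \<Rightarrow> nat \<Rightarrow> (nat \<Rightarrow> real) \<Rightarrow> real vec" where
  "qvee m p q = vec m (\<lambda>i. Min ((\<lambda>k. q (k * m + i)) ` {..<p}))"

end

theory Submission
  imports Defs
begin

text \<open>If \<open>x\<close> is an integer point of \<open>P\<close>, then shifting an infinitesimal mass of \<open>X\<close> to \<open>x\<close> respects the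
  constraint, and maximality gives \<open>Pr[X = x] \<ge> exp (- H(X))\<close>. Hence the number of integer points is
  at most \<open>exp H(X) * Pr[AX = b]\<close>, and only the probability has to be bounded.

  For a prime \<open>N\<close>, Fourier inversion on \<open>(\<int>/N)\<^sup>m\<close> bounds \<open>Pr[AX \<equiv> b mod N]\<close> by the mean over \<open>t\<close> of
  the product over \<open>j\<close> of \<open>|\<phi>\<^sub>j(2 \<pi> \<langle>a\<^sub>j, t\<rangle> / N)|\<close>, where \<open>\<phi>\<^sub>j\<close> is the characteristic function of
  \<open>X\<^sub>j\<close>. The AM-GM inequality over the \<open>p\<close> blocks of columns reduces this to the mean of the \<open>p\<close>-th power
  of the product over a single block. If \<open>N\<close> divides none of the block determinants, each block permutes
  \<open>(\<int>/N)\<^sup>m\<close>, so this mean factors into \<open>m\<close> one-dimensional sums. Since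
  \<open>|\<phi>\<^sub>j(\<theta>)|\<^sup>p \<le> 1 / (1 + (p/2) d sin\<^sup>2(\<theta>/2))\<close> with \<open>d = 4 q / (1 - q)\<^sup>2\<close>, each factor is
  \<open>O(p\<^sup>-\<^sup>1\<^sup>/\<^sup>2)\<close> once \<open>N \<ge> p\<close>. The term \<open>(C')\<^sup>p\<close> is not needed: \<open>C' = 0\<close>.\<close>

subsection \<open>Maximum entropy\<close>

lemma entropy_summand_nonneg: "0 \<le> - (pmf X k * ln (pmf X k))"
proof (cases "pmf X k = 0")
  case False
  then have "0 < pmf X k" by (simp add: pmf_pos)
  then have "ln (pmf X k) \<le> 0" by (simp add: pmf_le_1)
  then show ?thesis by (simp add: mult_nonneg_nonpos)
qed simp

text \<open>Both sides are suprema of finite partial sums, because the summands are nonnegative.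
  This moves the entropy to real sums, which can be split and differentiated.\<close>

lemma pmf_entropy_has_sum:
  assumes "((\<lambda>k. - (pmf X k * ln (pmf X k))) has_sum h) UNIV"
  shows "pmf_entropy X = ennreal h"
proof -
  have "ennreal h = (SUP F\<in>{F. finite F}. ennreal (\<Sum>k\<in>F. - (pmf X k * ln (pmf X k))))"
    using infsum_nonneg_is_SUPREMUM_ennreal[OF has_sum_imp_summable[OF assms] entropy_summand_nonneg]
      infsumI[OF assms] by simp
  also have "\<dots> = pmf_entropy X"
    unfolding pmf_entropy_def
    by (subst nonneg_infsum_complete) (auto simp: sum_ennreal[OF entropy_summand_nonneg])
  finally show ?thesis ..
qed

lemma pmf_has_sum_1: "(pmf X has_sum 1) UNIV"
proof -
  have "Infinite_Set_Sum.abs_summable_on (pmf X) UNIV" by (rule pmf_abs_summable)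
  moreover have "infsetsum (pmf X) UNIV = 1" by (rule infsetsum_pmf_eq_1) simp
  ultimately have "infsum (pmf X) UNIV = 1" "pmf X summable_on UNIV"
    by (auto simp: infsetsum_infsum simp flip: abs_summable_equivalent intro: abs_summable_summable)
  then show ?thesis by (simp add: has_sum_infsum[of "pmf X" UNIV, simplified] summable_iff_has_sum_infsum)
qed

lemma integrable_pmf_iff:
  fixes f :: "'a \<Rightarrow> real"
  shows "integrable (measure_pmf X) f \<longleftrightarrow> integrable (count_space UNIV) (\<lambda>k. pmf X k * f k)"
  unfolding measure_pmf_eq_density by (subst integrable_density) auto

lemma integral_pmf_eq:
  fixes f :: "'a \<Rightarrow> real"
  shows "measure_pmf.expectation X f = (\<integral>k. pmf X k * f k \<partial>count_space UNIV)"
  unfolding measure_pmf_eq_density by (subst integral_density) auto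

text \<open>The entropy series is the expectation of \<open>- ln (pmf X k)\<close>, so integrability
  of the logarithm is its absolute convergence.\<close>

lemma entropy_summable:
  assumes "integrable (measure_pmf X) (\<lambda>k. ln (pmf X k))"
  shows "(\<lambda>k. - (pmf X k * ln (pmf X k))) summable_on UNIV"
proof -
  have "Infinite_Set_Sum.abs_summable_on (\<lambda>k. pmf X k * ln (pmf X k)) UNIV"
    using assms unfolding integrable_pmf_iff by (simp add: Infinite_Set_Sum.abs_summable_on_def)
  then have "(\<lambda>k. pmf X k * ln (pmf X k)) summable_on UNIV"
    by (auto simp flip: abs_summable_equivalent intro: abs_summable_summable)
  then show ?thesis by (simp add: summable_on_uminus)
qed

section \<open>Perturbing a law by a point mass\<close>

definition point_mixture :: "real \<Rightarrow> 'a \<Rightarrow> 'a pmf \<Rightarrow> 'a pmf" where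
  "point_mixture \<epsilon> x X = bind_pmf (bernoulli_pmf \<epsilon>) (\<lambda>b. if b then return_pmf x else X)"

lemma pmf_point_mixture:
  assumes "0 \<le> \<epsilon>" "\<epsilon> \<le> 1"
  shows "pmf (point_mixture \<epsilon> x X) k = \<epsilon> * indicator {x} k + (1 - \<epsilon>) * pmf X k"
  using assms by (simp add: point_mixture_def pmf_bind indicator_def)

lemma
  fixes f :: "'a \<Rightarrow> real"
  assumes "0 \<le> \<epsilon>" "\<epsilon> \<le> 1" "integrable (measure_pmf X) f"
  shows integrable_point_mixture: "integrable (measure_pmf (point_mixture \<epsilon> x X)) f"
    and expectation_point_mixture: "measure_pmf.expectation (point_mixture \<epsilon> x X) f
      = \<epsilon> * f x + (1 - \<epsilon>) * measure_pmf.expectation X f"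
proof -
  have eq: "pmf (point_mixture \<epsilon> x X) k * f k
      = \<epsilon> * f x * indicator {x} k + (1 - \<epsilon>) * (pmf X k * f k)" for k
    using assms by (simp add: pmf_point_mixture algebra_simps indicator_def)
  have i1: "integrable (count_space UNIV) (\<lambda>k. \<epsilon> * f x * indicator {x} k)"
    by (intro integrable_mult_right integrable_real_indicator) auto
  have i2: "integrable (count_space UNIV) (\<lambda>k. (1 - \<epsilon>) * (pmf X k * f k))"
    using assms(3) unfolding integrable_pmf_iff by (rule integrable_mult_right)
  show "integrable (measure_pmf (point_mixture \<epsilon> x X)) f"
    unfolding integrable_pmf_iff eq using i1 i2 by (rule Bochner_Integration.integrable_add)
  show "measure_pmf.expectation (point_mixture \<epsilon> x X) f
      = \<epsilon> * f x + (1 - \<epsilon>) * measure_pmf.expectation X f"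
    unfolding integral_pmf_eq eq Bochner_Integration.integral_add[OF i1 i2]
    by (simp add: lebesgue_integral_count_space_finite_support)
qed

text \<open>Away from \<open>x\<close> all masses are scaled by \<open>1 - \<epsilon>\<close>, and
  the logarithm of the product splits into a multiple of the entropy terms and a multiple of the
  masses. The atom at \<open>x\<close>, of mass \<open>u\<close>, is treated separately.\<close>

lemma pmf_entropy_point_mixture:
  fixes x :: 'a
  assumes H: "((\<lambda>k. - (pmf X k * ln (pmf X k))) has_sum h) UNIV"
    and "0 \<le> \<epsilon>" "\<epsilon> < 1"
  defines "u \<equiv> \<epsilon> + (1 - \<epsilon>) * pmf X x"
  shows "pmf_entropy (point_mixture \<epsilon> x X) = ennreal ((1 - \<epsilon>) * (h + pmf X x * ln (pmf X x))
    - (1 - \<epsilon>) * ln (1 - \<epsilon>) * (1 - pmf X x) - u * ln u)"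
proof (rule pmf_entropy_has_sum)
  define Y where "Y = point_mixture \<epsilon> x X"
  have Yx: "pmf Y x = u" and Y: "k \<noteq> x \<Longrightarrow> pmf Y k = (1 - \<epsilon>) * pmf X k" for k
    using assms by (auto simp: Y_def pmf_point_mixture u_def)
  have rest: "(f has_sum (s - f x)) (- {x})" if "(f has_sum s) UNIV" for f :: "'a \<Rightarrow> real" and s
  proof -
    have "(f has_sum (s - f x)) (UNIV - {x})"
      using that by (intro has_sum_Diff has_sum_finite[of "{x}" f, simplified]) auto
    then show ?thesis by (simp add: Compl_eq_Diff_UNIV)
  qed
  have eq: "- (pmf Y k * ln (pmf Y k))
      = (1 - \<epsilon>) * - (pmf X k * ln (pmf X k)) + (- (1 - \<epsilon>) * ln (1 - \<epsilon>)) * pmf X k"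
    if "k \<in> - {x}" for k
  proof (cases "pmf X k = 0")
    case False
    then have "ln ((1 - \<epsilon>) * pmf X k) = ln (1 - \<epsilon>) + ln (pmf X k)"
      using assms(3) by (intro ln_mult_pos) (auto simp: pmf_pos)
    then show ?thesis using that by (simp add: Y) (simp add: algebra_simps)
  qed (use that in \<open>simp add: Y\<close>)
  have "((\<lambda>k. (1 - \<epsilon>) * - (pmf X k * ln (pmf X k)) + (- (1 - \<epsilon>) * ln (1 - \<epsilon>)) * pmf X k)
      has_sum ((1 - \<epsilon>) * (h - - (pmf X x * ln (pmf X x)))
        + (- (1 - \<epsilon>) * ln (1 - \<epsilon>)) * (1 - pmf X x))) (- {x})"
    by (intro has_sum_add has_sum_cmult_right rest[OF H] rest[OF pmf_has_sum_1])
  then have "((\<lambda>k. - (pmf Y k * ln (pmf Y k))) has_sum ((1 - \<epsilon>) * (h - - (pmf X x * ln (pmf X x)))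
        + (- (1 - \<epsilon>) * ln (1 - \<epsilon>)) * (1 - pmf X x))) (- {x})"
    by (subst has_sum_cong[OF eq])
  then have "((\<lambda>k. - (pmf Y k * ln (pmf Y k))) has_sum (- (u * ln u)
      + ((1 - \<epsilon>) * (h - - (pmf X x * ln (pmf X x)))
        + (- (1 - \<epsilon>) * ln (1 - \<epsilon>)) * (1 - pmf X x)))) (insert x (- {x}))"
    unfolding Yx[symmetric] by (intro has_sum_insert) auto
  moreover have "insert x (- {x}) = UNIV" by auto
  ultimately show "((\<lambda>k. - (pmf (point_mixture \<epsilon> x X) k * ln (pmf (point_mixture \<epsilon> x X) k)))
    has_sum ((1 - \<epsilon>) * (h + pmf X x * ln (pmf X x))
    - (1 - \<epsilon>) * ln (1 - \<epsilon>) * (1 - pmf X x) - u * ln u)) UNIV"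
    by (simp add: Y_def algebra_simps)
qed

text \<open>Moving an infinitesimal amount of mass to a feasible point \<open>x\<close> keeps the constraint and
  changes the entropy at rate \<open>- ln Pr[X = x] - H(X)\<close>.\<close>

lemma max_entropy_pmf_ge:
  assumes max: "max_entropy_vec A b X"
    and int: "integrable (measure_pmf X) (\<lambda>k. ln (pmf X k))"
    and x: "x \<in> carrier_vec (dim_col A)" "A *\<^sub>v map_vec real x = b" "0 < pmf X x"
  shows "exp (- enn2real (pmf_entropy X)) \<le> pmf X x"
proof -
  define h where "h = (\<Sum>\<^sub>\<infinity>k. - (pmf X k * ln (pmf X k)))"
  have H: "((\<lambda>k. - (pmf X k * ln (pmf X k))) has_sum h) UNIV"
    unfolding h_def using entropy_summable[OF int] by (rule has_sum_infsum)
  have h0: "h \<ge> 0" unfolding h_def by (intro infsum_nonneg entropy_summand_nonneg)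
  have Hh: "pmf_entropy X = ennreal h" by (rule pmf_entropy_has_sum[OF H])
  define P where "P = pmf X x"
  define f where "f \<epsilon> = (1 - \<epsilon>) * (h + P * ln P) - (1 - \<epsilon>) * ln (1 - \<epsilon>) * (1 - P)
    - (\<epsilon> + (1 - \<epsilon>) * P) * ln (\<epsilon> + (1 - \<epsilon>) * P)" for \<epsilon> :: real
  have le: "f \<epsilon> \<le> h" if "0 \<le> \<epsilon>" "\<epsilon> < 1" for \<epsilon>
  proof -
    have "point_mixture \<epsilon> x X \<in> mean_constrained A b"
    proof -
      have "set_pmf (point_mixture \<epsilon> x X) \<subseteq> insert x (set_pmf X)"
        by (auto simp: point_mixture_def split: if_splits)
      moreover have "X \<in> mean_constrained A b" using max by (simp add: max_entropy_vec_def)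
      \<comment> \<open>Since \<open>x\<close> itself solves the linear system, the mixture averages
        \<open>b\<close> with \<open>b\<close>.\<close>
      moreover have "\<epsilon> * c + (1 - \<epsilon>) * c = c" for c by (simp add: algebra_simps)
      ultimately show ?thesis
        using x that unfolding mean_constrained_def
        by (auto simp: integrable_point_mixture expectation_point_mixture)
    qed
    then have "pmf_entropy (point_mixture \<epsilon> x X) \<le> pmf_entropy X"
      using max by (simp add: max_entropy_vec_def)
    then have "ennreal (f \<epsilon>) \<le> ennreal h"
      unfolding Hh pmf_entropy_point_mixture[OF H that] f_def P_def .
    then show ?thesis using h0 by (simp add: ennreal_le_iff)
  qed
  have P: "0 < P" using x by (simp add: P_def)
  \<comment> \<open>Differentiating the two logarithmic terms produces \<open>1 - P\<close> with
    opposite signs, which cancels. Positivity of \<open>P\<close> makes \<open>u * ln u\<close>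
    differentiable at \<open>u = P\<close>.\<close>
  have "(f has_real_derivative (- h - ln P)) (at 0)"
    unfolding f_def using P
    by (auto intro!: derivative_eq_intros simp: field_simps)
  have "- h - ln P \<le> 0"
  proof (rule ccontr)
    assume "\<not> ?thesis"
    then obtain d where d: "d > 0" "\<And>\<epsilon>. 0 < \<epsilon> \<Longrightarrow> \<epsilon> < d \<Longrightarrow> f 0 < f (0 + \<epsilon>)"
      using DERIV_pos_inc_right[OF \<open>(f has_real_derivative (- h - ln P)) (at 0)\<close>] by auto
    \<comment> \<open>A positive derivative would push \<open>f\<close> above \<open>f 0 = h\<close>
      just to the right of 0; \<open>e\<close> lies in that range and below 1, where
      \<open>le\<close> forbids it.\<close>
    define e where "e = min (d/2) (1/2)"
    have e: "0 < e" "e < d" "e < 1" using d(1) by (auto simp: e_def)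
    then have "f 0 < f e" using d(2)[of e] by simp
    moreover have "f 0 = h" by (simp add: f_def)
    ultimately show False using le[of e] e by simp
  qed
  then have "exp (- h) \<le> exp (ln P)" unfolding exp_le_cancel_iff by simp
  also have "\<dots> = P" using P by simp
  finally show ?thesis using h0 Hh by (simp add: P_def)
qed

subsection \<open>Characteristic functions of geometric distributions\<close>

text \<open>Integral comparison: by the mean value theorem and monotonicity, each term is at most
  the increment of \<open>arctan (s * x) / s\<close> over the unit interval ending at
  \<open>r\<close>, and the increments telescope.\<close>

lemma sum_inverse_quadratic_le_arctan:
  fixes s :: real
  assumes "s > 0"
  shows "(\<Sum>r=1..R. 1 / (1 + (s * real r)\<^sup>2)) \<le> arctan (s * real R) / s"
proof (induction R)
  case (Suc R)
  have "\<exists>z. s * real R < z \<and> z < s * real (Suc R) \<and>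
      arctan (s * real (Suc R)) - arctan (s * real R)
        = (s * real (Suc R) - s * real R) * inverse (1 + z\<^sup>2)"
    using assms by (intro MVT2) (auto intro!: DERIV_arctan)
  then obtain z where z: "s * real R < z" "z < s * real (Suc R)"
    "arctan (s * real (Suc R)) - arctan (s * real R) = s * inverse (1 + z\<^sup>2)"
    by (auto simp: algebra_simps)
  have "0 \<le> s * real R" using assms by simp
  then have "z\<^sup>2 \<le> (s * real (Suc R))\<^sup>2" using z by (intro power_mono) auto
  then have "1 / (1 + (s * real (Suc R))\<^sup>2) \<le> inverse (1 + z\<^sup>2)"
    by (simp add: divide_simps add_pos_nonneg)
  also have "\<dots> = (arctan (s * real (Suc R)) - arctan (s * real R)) / s"
    using z(3) assms by simp
  finally show ?case using Suc.IH by (simp add: diff_divide_distrib)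
qed simp

lemma sum_inverse_quadratic_le:
  fixes s :: real
  assumes "s > 0"
  shows "(\<Sum>r=1..R. 1 / (1 + (s * real r)\<^sup>2)) \<le> pi / (2 * s)"
proof -
  have "arctan (s * real R) / s \<le> (pi / 2) / s"
    using assms arctan_ubound[of "s * real R"] by (intro divide_right_mono) auto
  with sum_inverse_quadratic_le_arctan[OF assms, of R] show ?thesis by simp
qed

text \<open>Jordan's inequality: the concave sine lies above its chord from 0 to
  \<open>pi / 2\<close>.\<close>

lemma two_x_le_sin_pi:
  fixes x :: real
  assumes "0 \<le> x" "x \<le> 1/2"
  shows "2 * x \<le> sin (pi * x)"
proof -
  have "concave_on {0..pi} sin"
    by (rule f''_le0_imp_concave[where f' = cos and f'' = "\<lambda>x. - sin x"])
      (auto intro!: derivative_eq_intros sin_ge_zero)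
  then have "(1 - 2 * x) * sin 0 + (2 * x) * sin (pi/2)
      \<le> sin ((1 - 2 * x) *\<^sub>R 0 + (2 * x) *\<^sub>R (pi/2))"
    using assms by (intro concave_onD) auto
  then show ?thesis by (simp add: mult.commute)
qed

text \<open>Jordan's inequality replaces the sine by a linear function for \<open>r\<close> up to
  \<open>N / 2\<close>, and the reflection \<open>r\<close> to \<open>N - r\<close> handles the
  rest. The two halves are then \<open>arctan\<close> sums; the isolated 1 is the term
  \<open>r = 0\<close>.\<close>

lemma sum_inverse_sin_squared_le:
  fixes K :: real
  assumes "K > 0" "N > 0"
  shows "(\<Sum>r<N. 1 / (1 + K * (sin (pi * real r / real N))\<^sup>2)) \<le> 1 + real N * pi / (2 * sqrt K)"
proof -
  \<comment> \<open>Chosen so that \<open>(s * r)^2 = K * (2 * r / N)^2\<close>.\<close>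
  define s where "s = 2 * sqrt K / real N"
  have s: "s > 0" using assms by (simp add: s_def)
  have half: "1 / (1 + K * (sin (pi * real r / real N))\<^sup>2) \<le> 1 / (1 + (s * real r)\<^sup>2)"
    if "2 * r \<le> N" for r
  proof -
    have "2 * (real r / real N) \<le> sin (pi * (real r / real N))"
      using that assms by (intro two_x_le_sin_pi) (auto simp: field_simps)
    then have "(2 * (real r / real N))\<^sup>2 \<le> (sin (pi * real r / real N))\<^sup>2"
      by (intro power_mono) auto
    then have "K * (2 * (real r / real N))\<^sup>2 \<le> K * (sin (pi * real r / real N))\<^sup>2"
      using assms by (intro mult_left_mono) auto
    moreover have "K * (2 * (real r / real N))\<^sup>2 = (s * real r)\<^sup>2"
      using assms by (simp add: s_def power_mult_distrib power_divide)
    ultimately have "(s * real r)\<^sup>2 \<le> K * (sin (pi * real r / real N))\<^sup>2" by simp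
    then show ?thesis using assms
      by (intro divide_left_mono mult_pos_pos) (auto simp: add_pos_nonneg)
  qed
  \<comment> \<open>Adding the bounds for \<open>r\<close> and for its reflection covers both halves
    without splitting the range of summation.\<close>
  have bound: "1 / (1 + K * (sin (pi * real r / real N))\<^sup>2)
      \<le> 1 / (1 + (s * real r)\<^sup>2) + 1 / (1 + (s * real (N - r))\<^sup>2)" if "r < N" for r
  proof (cases "2 * r \<le> N")
    case True
    have "0 \<le> 1 / (1 + (s * real (N - r))\<^sup>2)" by (simp add: add_pos_nonneg)
    with half[OF True] show ?thesis by linarith
  next
    case False
    have "sin (pi * real (N - r) / real N) = sin (pi - pi * real r / real N)"
      using that by (simp add: of_nat_diff diff_divide_distrib right_diff_distrib)
    then have "sin (pi * real (N - r) / real N) = sin (pi * real r / real N)" by simp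
    with half[of "N - r"] False
    have "1 / (1 + K * (sin (pi * real r / real N))\<^sup>2) \<le> 1 / (1 + (s * real (N - r))\<^sup>2)" by simp
    moreover have "0 \<le> 1 / (1 + (s * real r)\<^sup>2)" by (simp add: add_pos_nonneg)
    ultimately show ?thesis by linarith
  qed
  have "(\<Sum>r<N. 1 / (1 + K * (sin (pi * real r / real N))\<^sup>2))
      \<le> (\<Sum>r<N. 1 / (1 + (s * real r)\<^sup>2)) + (\<Sum>r<N. 1 / (1 + (s * real (N - r))\<^sup>2))"
    unfolding sum.distrib[symmetric] using bound by (intro sum_mono) auto
  also have "(\<Sum>r<N. 1 / (1 + (s * real (N - r))\<^sup>2)) = (\<Sum>r=1..N. 1 / (1 + (s * real r)\<^sup>2))"
    by (rule sum.reindex_bij_witness[of _ "\<lambda>r. N - r" "\<lambda>r. N - r"]) auto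
  also have "(\<Sum>r<N. 1 / (1 + (s * real r)\<^sup>2)) = 1 + (\<Sum>r=1..N-1. 1 / (1 + (s * real r)\<^sup>2))"
  proof -
    have "{..<N} = insert 0 {1..N-1}" using assms by auto
    then show ?thesis by simp
  qed
  finally have "(\<Sum>r<N. 1 / (1 + K * (sin (pi * real r / real N))\<^sup>2)) \<le> 1 + pi / (2 * s) + pi / (2 * s)"
    using sum_inverse_quadratic_le[OF s, of N] sum_inverse_quadratic_le[OF s, of "N-1"] by linarith
  also have "\<dots> = 1 + real N * pi / (2 * sqrt K)"
    using assms by (simp add: s_def field_simps)
  finally show ?thesis .
qed

section \<open>Decay of the characteristic function\<close>

text \<open>Bernoulli's inequality with exponent \<open>p / 2\<close>, squared so that only natural
  exponents occur. The case \<open>p = 2\<close> is an equality and starts the induction.\<close>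

lemma bernoulli_half_power:
  fixes y :: real
  assumes "y \<ge> 0" "p \<ge> 2"
  shows "(1 + real p / 2 * y)\<^sup>2 \<le> (1 + y) ^ p"
  using assms(2)
proof (induction p rule: nat_induct_at_least)
  case (Suc p)
  have "(1 + real (Suc p) / 2 * y)\<^sup>2 \<le> (1 + real p / 2 * y)\<^sup>2 * (1 + y)"
  proof -
    have "(1 + real p / 2 * y)\<^sup>2 * (1 + y) - (1 + real (Suc p) / 2 * y)\<^sup>2
        = (real p / 2 - 1/4) * y\<^sup>2 + (real p / 2)\<^sup>2 * y ^ 3"
      by (simp add: power2_eq_square power3_eq_cube field_simps)
    also have "\<dots> \<ge> 0" using Suc assms by (intro add_nonneg_nonneg mult_nonneg_nonneg) auto
    finally show ?thesis by simp
  qed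
  also have "\<dots> \<le> (1 + y) ^ p * (1 + y)"
    using Suc assms by (intro mult_right_mono) auto
  finally show ?case by (simp add: mult.commute)
qed (simp add: power2_eq_square)

lemma geometric_characteristic_function:
  fixes q \<theta> :: real
  assumes "0 \<le> q" "q < 1"
  shows "measure_pmf.expectation (geometric_pmf (1 - q)) (\<lambda>k. cis (\<theta> * real k))
    = (1 - q) / (1 - q * cis \<theta>)"
proof -
  have n: "norm (q * cis \<theta>) < 1" using assms by (simp add: norm_mult)
  have eq: "pmf (geometric_pmf (1 - q)) k *\<^sub>R cis (\<theta> * real k) = (1 - q) * (q * cis \<theta>) ^ k" for k
    using assms by (simp add: scaleR_conv_of_real power_mult_distrib Complex.DeMoivre mult_ac)
  have s: "(\<lambda>k. (1 - q) * (q * cis \<theta>) ^ k) sums ((1 - q) * (1 / (1 - q * cis \<theta>)))"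
    using n by (intro sums_mult geometric_sums)
  have "summable (\<lambda>k. norm ((1 - q) * (q * cis \<theta>) ^ k))"
    unfolding norm_mult norm_power using assms by (intro summable_mult summable_geometric) (auto simp: norm_mult)
  then have i: "integrable (count_space UNIV) (\<lambda>k. (1 - q) * (q * cis \<theta>) ^ k)"
    by (simp add: integrable_count_space_nat_iff)
  have "measure_pmf.expectation (geometric_pmf (1 - q)) (\<lambda>k. cis (\<theta> * real k))
     = (\<integral>k. pmf (geometric_pmf (1 - q)) k *\<^sub>R cis (\<theta> * real k) \<partial>count_space UNIV)"
    unfolding measure_pmf_eq_density by (subst integral_density) auto
  also have "\<dots> = (\<Sum>k. (1 - q) * (q * cis \<theta>) ^ k)"
    unfolding eq by (rule integral_count_space_nat[OF i])
  finally show ?thesis using s by (simp add: sums_iff)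
qed

text \<open>The denominator satisfies \<open>|1 - q * cis \<theta>|^2 = (1 - q)^2 + 4 * q *
  sin(\<theta>/2)^2\<close>, by the half-angle formula.\<close>

lemma norm_geometric_characteristic_function:
  fixes q \<theta> :: real
  assumes "0 \<le> q" "q < 1"
  shows "(norm (measure_pmf.expectation (geometric_pmf (1 - q)) (\<lambda>k. cis (\<theta> * real k))))\<^sup>2
    = 1 / (1 + 4 * q / (1 - q)\<^sup>2 * (sin (\<theta> / 2))\<^sup>2)"
proof -
  have "(norm (1 - q * cis \<theta>))\<^sup>2 = 1 - 2 * q * cos \<theta> + q\<^sup>2 * ((cos \<theta>)\<^sup>2 + (sin \<theta>)\<^sup>2)"
    unfolding cmod_power2 by (simp add: power2_eq_square algebra_simps del: sin_cos_squared_add3)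
  then have "(norm (1 - q * cis \<theta>))\<^sup>2 = 1 - 2 * q * cos \<theta> + q\<^sup>2" by simp
  moreover have "cos \<theta> = 1 - 2 * (sin (\<theta> / 2))\<^sup>2"
    using cos_double_sin[of "\<theta>/2"] by simp
  ultimately have "(norm (1 - q * cis \<theta>))\<^sup>2 = 1 - 2 * q * (1 - 2 * (sin (\<theta> / 2))\<^sup>2) + q\<^sup>2"
    by simp
  then have "(norm (1 - q * cis \<theta>))\<^sup>2 = (1 - q)\<^sup>2 + 4 * q * (sin (\<theta> / 2))\<^sup>2"
    by (simp add: power2_eq_square algebra_simps)
  moreover have "norm (1 - complex_of_real q) = 1 - q"
    using assms norm_of_real[of "1 - q", where 'a = complex] by simp
  ultimately show ?thesis
    using assms unfolding geometric_characteristic_function[OF assms] norm_divide power_divide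
    by (simp add: divide_simps)
qed

text \<open>As \<open>4 * q / (1 - q)^2\<close> increases with \<open>q\<close>, the parameter may
  be lowered to \<open>q0\<close>. Bernoulli's inequality for \<open>p / 2\<close> then linearizes
  the power; the comparison is made between squares.\<close>

lemma norm_geometric_characteristic_function_power_le:
  fixes q q0 \<theta> :: real
  assumes "0 \<le> q0" "q0 \<le> q" "q < 1" "p \<ge> 2"
  shows "norm (measure_pmf.expectation (geometric_pmf (1 - q)) (\<lambda>k. cis (\<theta> * real k))) ^ p
    \<le> 1 / (1 + real p * 2 * q0 / (1 - q0)\<^sup>2 * (sin (\<theta> / 2))\<^sup>2)"
proof -
  define x where "x = norm (measure_pmf.expectation (geometric_pmf (1 - q)) (\<lambda>k. cis (\<theta> * real k)))"
  define y where "y = 4 * q0 / (1 - q0)\<^sup>2 * (sin (\<theta> / 2))\<^sup>2"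
  have y0: "y \<ge> 0" using assms by (simp add: y_def)
  have "4 * q0 / (1 - q0)\<^sup>2 \<le> 4 * q / (1 - q)\<^sup>2"
    using assms by (intro frac_le) (auto intro!: power_mono)
  then have "y \<le> 4 * q / (1 - q)\<^sup>2 * (sin (\<theta> / 2))\<^sup>2"
    unfolding y_def by (intro mult_right_mono) auto
  then have x2: "x\<^sup>2 \<le> 1 / (1 + y)"
    using assms y0 norm_geometric_characteristic_function[of q \<theta>]
    by (auto simp: x_def intro!: divide_left_mono mult_pos_pos)
  have "(x ^ p)\<^sup>2 = (x\<^sup>2) ^ p" by (simp add: power_mult[symmetric] mult.commute)
  also have "\<dots> \<le> (1 / (1 + y)) ^ p" using x2 by (intro power_mono) auto
  also have "\<dots> = 1 / (1 + y) ^ p" by (simp add: power_divide)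
  also have "\<dots> \<le> 1 / (1 + real p / 2 * y)\<^sup>2"
    using bernoulli_half_power[OF y0 assms(4)] y0
    by (intro divide_left_mono mult_pos_pos zero_less_power) (auto simp: add_pos_nonneg)
  also have "\<dots> = (1 / (1 + real p / 2 * y))\<^sup>2" by (simp add: power_divide)
  finally have "x ^ p \<le> 1 / (1 + real p / 2 * y)"
    using y0 by (auto intro: power2_le_imp_le)
  then show ?thesis by (simp add: x_def y_def mult_ac)
qed

text \<open>A full geometric sum over powers of an \<open>N\<close>-th root of unity is
  \<open>N\<close> or 0; only its being a nonnegative real is recorded.\<close>

lemma sum_roots_of_unity_nonneg:
  fixes z :: int
  assumes "N > 0"
  shows "\<exists>c::real. 0 \<le> c \<and> (\<Sum>r<N. cis (2 * pi * real r * of_int z / real N)) = of_real c"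
proof -
  define w where "w = cis (2 * pi * of_int z / real N)"
  have "w ^ N = cis (of_int z * (2 * pi))" using assms by (simp add: w_def Complex.DeMoivre mult_ac)
  also have "\<dots> = 1" by (simp add: complex_eq_iff mult.commute[of _ "2 * pi"])
  finally have wN: "w ^ N = 1" .
  have "(\<Sum>r<N. cis (2 * pi * real r * of_int z / real N)) = (\<Sum>r<N. w ^ r)"
    by (simp add: w_def Complex.DeMoivre mult_ac)
  also have "\<dots> = of_real (if w = 1 then real N else 0)"
    using wN by (simp add: sum_gp_strict)
  finally show ?thesis by (intro exI[of _ "if w = 1 then real N else 0"]) auto
qed

subsection \<open>Independent geometric coordinates\<close>

lemma prod_cis: "finite I \<Longrightarrow> (\<Prod>i\<in>I. cis (f i)) = cis (\<Sum>i\<in>I. f i)"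
  by (induction I rule: finite_induct) (auto simp: cis_mult)

lemma pmf_indep_geometric_coords:
  fixes X :: "nat vec pmf" and q :: "nat \<Rightarrow> real"
  assumes X: "indep_geometric_coords n X q" "set_pmf X \<subseteq> carrier_vec n"
    and x: "x \<in> carrier_vec n" and "n > 0"
  shows "pmf X x = (\<Prod>j<n. (1 - q j) * q j ^ (x $ j))"
proof -
  have "pmf X x = measure_pmf.prob X ({x} \<inter> set_pmf X)"
    by (simp add: measure_Int_set_pmf measure_pmf_single)
  \<comment> \<open>Coordinates determine a vector only once its dimension is known, hence the
    intersection with the support.\<close>
  also have "{x} \<inter> set_pmf X = (\<Inter>j\<in>{..<n}. (\<lambda>k. k $ j) -` {x $ j} \<inter> space (measure_pmf X)) \<inter> set_pmf X"
    using x X(2) \<open>n > 0\<close> by (auto intro!: eq_vecI)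
  also have "measure_pmf.prob X \<dots>
      = measure_pmf.prob X (\<Inter>j\<in>{..<n}. (\<lambda>k. k $ j) -` {x $ j} \<inter> space (measure_pmf X))"
    by (rule measure_Int_set_pmf)
  also have "\<dots> = (\<Prod>j<n. measure_pmf.prob X ((\<lambda>k. k $ j) -` {x $ j} \<inter> space (measure_pmf X)))"
    using X(1) \<open>n > 0\<close> unfolding indep_geometric_coords_def
    by (intro prob_space.indep_varsD_finite[OF prob_space_measure_pmf]) auto
  also have "\<dots> = (\<Prod>j<n. pmf (map_pmf (\<lambda>k. k $ j) X) (x $ j))"
    by (simp add: pmf_map)
  also have "\<dots> = (\<Prod>j<n. (1 - q j) * q j ^ (x $ j))"
    using X(1) by (intro prod.cong) (auto simp: indep_geometric_coords_def mult.commute)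
  finally show ?thesis .
qed

text \<open>On the support the logarithm of the product formula is affine in the coordinates, and
  geometric variables have finite mean. Positive \<open>q j\<close> keep every logarithm away from
  \<open>ln 0\<close>.\<close>

lemma integrable_ln_pmf_indep_geometric_coords:
  fixes X :: "nat vec pmf" and q :: "nat \<Rightarrow> real"
  assumes X: "indep_geometric_coords n X q" "set_pmf X \<subseteq> carrier_vec n"
    and q: "\<And>j. j < n \<Longrightarrow> 0 < q j" and "n > 0"
  shows "integrable (measure_pmf X) (\<lambda>k. ln (pmf X k))"
proof -
  have q1: "q j < 1" "map_pmf (\<lambda>k. k $ j) X = geometric_pmf (1 - q j)" if "j < n" for j
    using X(1) that by (auto simp: indep_geometric_coords_def)
  have "integrable (measure_pmf X) (\<lambda>k. \<Sum>j<n. ln (1 - q j) + real (k $ j) * ln (q j))"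
  proof (intro Bochner_Integration.integrable_sum Bochner_Integration.integrable_add
      integrable_mult_left)
    fix j assume "j \<in> {..<n}"
    then have "integrable (measure_pmf (map_pmf (\<lambda>k. k $ j) X)) real"
      using q1[of j] q[of j] by (simp add: integrable_real_geometric_pmf)
    then show "integrable (measure_pmf X) (\<lambda>k. real (k $ j))" by (simp add: integrable_map_pmf_eq)
  qed simp
  moreover have "ln (pmf X k) = (\<Sum>j<n. ln (1 - q j) + real (k $ j) * ln (q j))"
    if "k \<in> set_pmf X" for k
  proof -
    have pos: "(1 - q j) * q j ^ (k $ j) \<noteq> 0" if "j < n" for j
      using q1(1)[OF that] q[OF that] by simp
    have "ln (pmf X k) = (\<Sum>j<n. ln ((1 - q j) * q j ^ (k $ j)))"
      using that X(2) pos \<open>n > 0\<close>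
      by (subst pmf_indep_geometric_coords[OF X], blast, blast, intro ln_prod) blast+
    also have "\<dots> = (\<Sum>j<n. ln (1 - q j) + real (k $ j) * ln (q j))"
      using q q1(1) by (intro sum.cong refl) (simp add: ln_mult ln_realpow)
    finally show ?thesis .
  qed
  ultimately show ?thesis
    by (subst integrable_cong_AE[where g = "\<lambda>k. \<Sum>j<n. ln (1 - q j) + real (k $ j) * ln (q j)"])
      (auto simp: AE_measure_pmf_iff)
qed

lemma norm_expectation_indep_geometric_coords:
  fixes X :: "nat vec pmf" and q :: "nat \<Rightarrow> real"
  assumes X: "indep_geometric_coords n X q"
  shows "norm (measure_pmf.expectation X (\<lambda>k. cis (\<Sum>j<n. \<theta> j * real (k $ j))))
    = (\<Prod>j<n. norm (measure_pmf.expectation (geometric_pmf (1 - q j)) (\<lambda>k. cis (\<theta> j * real k))))"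
proof -
  have "prob_space.indep_vars (measure_pmf X) (\<lambda>_. borel) (\<lambda>j k. cis (\<theta> j * real (k $ j))) {..<n}"
    using X unfolding indep_geometric_coords_def
    by (intro prob_space.indep_vars_compose2[OF prob_space_measure_pmf, where X = "\<lambda>j (k::nat vec). k $ j" and Y = "\<lambda>j k. cis (\<theta> j * real k)"]) auto
  then have "measure_pmf.expectation X (\<lambda>k. \<Prod>j<n. cis (\<theta> j * real (k $ j)))
      = (\<Prod>j<n. measure_pmf.expectation X (\<lambda>k. cis (\<theta> j * real (k $ j))))"
    by (intro prob_space.indep_vars_lebesgue_integral[OF prob_space_measure_pmf] measure_pmf.integrable_const_bound[where B = 1]) auto
  also have "\<dots> = (\<Prod>j<n. measure_pmf.expectation (map_pmf (\<lambda>k. k $ j) X) (\<lambda>k. cis (\<theta> j * real k)))"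
    by simp
  also have "\<dots> = (\<Prod>j<n. measure_pmf.expectation (geometric_pmf (1 - q j)) (\<lambda>k. cis (\<theta> j * real k)))"
    using X by (intro prod.cong refl) (simp add: indep_geometric_coords_def del: integral_map_pmf)
  finally show ?thesis by (simp add: prod_cis prod_norm)
qed

section \<open>Fourier inversion modulo N\<close>

text \<open>The character sum \<open>S\<close> dominates \<open>N^m\<close> times the indicator of
  the event. Taking norms after the expectation removes the phases \<open>c t\<close>, and with them
  the reference point \<open>y\<close>.\<close>

lemma prob_lattice_coset_le:
  fixes X :: "nat vec pmf" and q :: "nat \<Rightarrow> real"
    and a :: "nat \<Rightarrow> nat \<Rightarrow> int" and y :: "nat \<Rightarrow> int"
  assumes X: "indep_geometric_coords n X q" and N: "N > 0"
  shows "real N ^ m * measure_pmf.prob X {x. \<forall>i<m. (\<Sum>j<n. a i j * (int (x $ j) - y j)) = 0}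
    \<le> (\<Sum>t\<in>PiE {..<m} (\<lambda>_. {..<N}). \<Prod>j<n. norm (measure_pmf.expectation (geometric_pmf (1 - q j))
          (\<lambda>k. cis (2 * pi * of_int (\<Sum>i<m. int (t i) * a i j) / real N * real k))))"
proof -
  define T where "T = PiE {..<m} (\<lambda>_. {..<N})"
  define z where "z x i = (\<Sum>j<n. a i j * (int (x $ j) - y j))" for x :: "nat vec" and i
  define E where "E = {x. \<forall>i<m. z x i = 0}"
  define \<theta> where "\<theta> t j = 2 * pi * of_int (\<Sum>i<m. int (t i) * a i j) / real N" for t :: "nat \<Rightarrow> nat" and j
  define c where "c t = cis (- (\<Sum>j<n. \<theta> t j * of_int (y j)))" for t
  define S where "S x = (\<Sum>t\<in>T. c t * cis (\<Sum>j<n. \<theta> t j * real (x $ j)))" for x :: "nat vec"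
  \<comment> \<open>Exchanging the sums over \<open>i\<close> and \<open>j\<close> groups the phase
    by rows, so the sum over \<open>t\<close> factors into one sum per row.\<close>
  have S: "S x = (\<Prod>i<m. \<Sum>r<N. cis (2 * pi * real r * of_int (z x i) / real N))" for x
  proof -
    have "c t * cis (\<Sum>j<n. \<theta> t j * real (x $ j))
        = (\<Prod>i<m. cis (2 * pi * real (t i) * of_int (z x i) / real N))" for t
    proof -
      have "- (\<Sum>j<n. \<theta> t j * of_int (y j)) + (\<Sum>j<n. \<theta> t j * real (x $ j))
          = (\<Sum>j<n. \<theta> t j * (real (x $ j) - of_int (y j)))"
        by (simp add: sum_subtractf right_diff_distrib)
      also have "\<dots> = (\<Sum>j<n. \<Sum>i<m. 2 * pi / real N * (real (t i) * of_int (a i j)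
          * (real (x $ j) - of_int (y j))))"
      proof (rule sum.cong)
        fix j
        show "\<theta> t j * (real (x $ j) - of_int (y j)) = (\<Sum>i<m. 2 * pi / real N * (real (t i) * of_int (a i j)
          * (real (x $ j) - of_int (y j))))"
          unfolding \<theta>_def sum_distrib_left[symmetric] sum_distrib_right[symmetric] by simp
      qed simp
      also have "\<dots> = (\<Sum>i<m. \<Sum>j<n. 2 * pi / real N * (real (t i) * of_int (a i j)
          * (real (x $ j) - of_int (y j))))"
        by (rule sum.swap)
      also have "\<dots> = (\<Sum>i<m. 2 * pi * real (t i) * of_int (z x i) / real N)"
      proof (rule sum.cong)
        fix i
        show "(\<Sum>j<n. 2 * pi / real N * (real (t i) * of_int (a i j) * (real (x $ j) - of_int (y j))))
          = 2 * pi * real (t i) * of_int (z x i) / real N"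
          unfolding z_def mult.assoc sum_distrib_left[symmetric] by simp
      qed simp
      finally show ?thesis by (simp add: c_def cis_mult prod_cis)
    qed
    then show ?thesis unfolding S_def T_def by (simp add: prod_sum_PiE)
  qed
  \<comment> \<open>Each factor is a nonnegative real and equals \<open>N\<close> if
    \<open>z x i = 0\<close>. Points solving the equations only modulo \<open>N\<close> can merely
    enlarge the right side.\<close>
  have pos: "real N ^ m * indicator E x \<le> Re (S x)" for x
  proof -
    have "\<forall>i. \<exists>d::real. 0 \<le> d \<and> (\<Sum>r<N. cis (2 * pi * real r * of_int (z x i) / real N)) = of_real d"
      using sum_roots_of_unity_nonneg[OF N] by blast
    then obtain d :: "nat \<Rightarrow> real" where d: "\<And>i. 0 \<le> d i"
      "\<And>i. (\<Sum>r<N. cis (2 * pi * real r * of_int (z x i) / real N)) = of_real (d i)"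
      by metis
    have Sd: "Re (S x) = (\<Prod>i<m. d i)" unfolding S d(2) of_real_prod[symmetric] by (rule Re_complex_of_real)
    show ?thesis
    proof (cases "x \<in> E")
      case True
      have "d i = real N" if "i < m" for i
      proof -
        have "complex_of_real (d i) = of_real (real N)"
          using True that by (simp add: d(2)[symmetric] E_def)
        then show ?thesis by (simp only: of_real_eq_iff)
      qed
      with True Sd show ?thesis by simp
    next
      case False
      then show ?thesis using Sd d(1) by (simp add: prod_nonneg)
    qed
  qed
  have iS: "integrable (measure_pmf X) S"
    unfolding S_def
    by (intro Bochner_Integration.integrable_sum integrable_mult_right
        measure_pmf.integrable_const_bound[where B = 1]) auto
  have "real N ^ m * measure_pmf.prob X E = measure_pmf.expectation X (\<lambda>x. real N ^ m * indicator E x)"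
    by simp
  also have "\<dots> \<le> measure_pmf.expectation X (\<lambda>x. Re (S x))"
    using iS pos by (intro integral_mono integrable_Re integrable_mult_right integrable_real_indicator)
      (auto simp: measure_pmf.emeasure_finite less_top[symmetric])
  also have "\<dots> = Re (measure_pmf.expectation X S)" using iS by (rule integral_Re)
  also have "\<dots> \<le> norm (measure_pmf.expectation X S)" by (rule complex_Re_le_cmod)
  also have "measure_pmf.expectation X S
      = (\<Sum>t\<in>T. c t * measure_pmf.expectation X (\<lambda>x. cis (\<Sum>j<n. \<theta> t j * real (x $ j))))"
    unfolding S_def
    by (subst Bochner_Integration.integral_sum)
      (auto intro!: integrable_mult_right measure_pmf.integrable_const_bound[where B = 1])
  also have "norm \<dots> \<le> (\<Sum>t\<in>T. norm (c t * measure_pmf.expectation X (\<lambda>x. cis (\<Sum>j<n. \<theta> t j * real (x $ j)))))"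
    by (rule norm_sum)
  also have "\<dots> = (\<Sum>t\<in>T. \<Prod>j<n. norm (measure_pmf.expectation (geometric_pmf (1 - q j))
          (\<lambda>k. cis (\<theta> t j * real k))))"
    by (simp add: norm_mult c_def norm_expectation_indep_geometric_coords[OF X])
  finally show ?thesis by (simp add: E_def z_def T_def \<theta>_def)
qed

subsection \<open>Blocks of columns\<close>

text \<open>AM-GM for the numbers \<open>f k ^ p\<close>, whose geometric mean is the product of the
  \<open>f k\<close>.\<close>

lemma prod_le_mean_power:
  fixes f :: "nat \<Rightarrow> real"
  assumes "p > 0" "\<And>k. k < p \<Longrightarrow> f k \<ge> 0"
  shows "(\<Prod>k<p. f k) \<le> (\<Sum>k<p. f k ^ p) / real p"
proof -
  have nn: "(\<Prod>k<p. f k) \<ge> 0" using assms by (intro prod_nonneg) auto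
  have "(\<Prod>k<p. f k) = ((\<Prod>k<p. f k) ^ p) powr (1 / real p)"
    using nn assms(1) by (cases "(\<Prod>k<p. f k) = 0")
      (simp_all add: powr_realpow[symmetric] powr_powr power_0_left del: prod_zero_iff)
  also have "\<dots> = (\<Prod>k<p. f k ^ p) powr (1 / real (card {..<p}))" by (simp add: prod_power_distrib)
  also have "\<dots> \<le> (\<Sum>k<p. f k ^ p / real (card {..<p}))"
    using assms by (intro arith_geom_mean) auto
  finally show ?thesis by (simp add: sum_divide_distrib)
qed

lemma prod_lessThan_blocks:
  fixes f :: "nat \<Rightarrow> 'a::comm_monoid_mult"
  shows "(\<Prod>j<p * m. f j) = (\<Prod>k<p. \<Prod>i<m. f (k * m + i))"
proof -
  have "(\<Prod>i<m. f (k * m + i)) = prod f {k * m..<k * m + m}" for k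
    using prod.shift_bounds_nat_ivl[of f 0 "k * m" m]
    by (simp add: add.commute atLeast0LessThan)
  then show ?thesis by (simp add: prod.nat_group)
qed

section \<open>Nonsingular matrices modulo a prime\<close>

text \<open>Multiplying by the adjugate turns the congruences into \<open>N dvd det B * u r\<close>,
  and the prime \<open>N\<close> does not divide the determinant.\<close>

lemma prime_dvd_of_mat_kernel:
  fixes a :: "nat \<Rightarrow> nat \<Rightarrow> int" and u :: "nat \<Rightarrow> int"
  assumes "prime N" "\<not> N dvd det (mat m m (\<lambda>(r, i). a r i))"
    and u: "\<And>i. i < m \<Longrightarrow> N dvd (\<Sum>r<m. u r * a r i)" and "r < m"
  shows "N dvd u r"
proof -
  define B where "B = mat m m (\<lambda>(i, r). a r i)"
  have B: "B \<in> carrier_mat m m" by (simp add: B_def)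
  have "B = transpose_mat (mat m m (\<lambda>(r, i). a r i))" by (auto simp: B_def)
  then have dB: "det B = det (mat m m (\<lambda>(r, i). a r i))"
    by (simp add: det_transpose[of _ m])
  define v where "v = vec m u"
  have v: "v \<in> carrier_vec m" by (simp add: v_def)
  have Bv: "(B *\<^sub>v v) $ i = (\<Sum>r<m. u r * a r i)" if "i < m" for i
    using that by (simp add: B_def v_def scalar_prod_def mult.commute atLeast0LessThan)
  have "adj_mat B *\<^sub>v (B *\<^sub>v v) = (det B \<cdot>\<^sub>m 1\<^sub>m m) *\<^sub>v v"
    using adj_mat[OF B] B v by (simp flip: assoc_mult_mat_vec[of _ m m _ m])
  also have "\<dots> = det B \<cdot>\<^sub>v v"
    using v by (intro eq_vecI) (auto simp: row_smult)
  finally have "adj_mat B *\<^sub>v (B *\<^sub>v v) = det B \<cdot>\<^sub>v v" .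
  then have "det B * u r = (adj_mat B *\<^sub>v (B *\<^sub>v v)) $ r"
    using \<open>r < m\<close> by (simp add: v_def)
  also have "\<dots> = (\<Sum>i<m. adj_mat B $$ (r, i) * (B *\<^sub>v v) $ i)"
    using adj_mat(1)[OF B] B \<open>r < m\<close> by (simp add: scalar_prod_def atLeast0LessThan)
  also have "N dvd \<dots>" using u by (intro dvd_sum dvd_mult) (simp add: Bv)
  finally show ?thesis using assms(1,2) by (simp add: dB prime_dvd_mult_iff)
qed

text \<open>Reducing the linear map modulo \<open>N\<close> gives an injection \<open>g\<close> of
  the index box into itself. The summands are nonnegative, so the sum over its image is at most the
  sum over the box, which factors.\<close>

lemma sum_PiE_nonsingular_le:
  fixes a :: "nat \<Rightarrow> nat \<Rightarrow> int" and w :: "nat \<Rightarrow> int \<Rightarrow> real"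
  assumes N: "prime N" "\<not> int N dvd det (mat m m (\<lambda>(r, i). a r i))"
    and w: "\<And>i z. 0 \<le> w i z" "\<And>i z. w i (z mod int N) = w i z"
  shows "(\<Sum>t\<in>PiE {..<m} (\<lambda>_. {..<N}). \<Prod>i<m. w i (\<Sum>r<m. int (t r) * a r i))
    \<le> (\<Prod>i<m. \<Sum>r<N. w i (int r))"
proof -
  define T where "T = PiE {..<m} (\<lambda>_. {..<N})"
  have finT: "finite T" by (simp add: T_def finite_PiE)
  have N0: "N > 0" using N(1) by (rule prime_gt_0_nat)
  define g where "g t = restrict (\<lambda>i. nat ((\<Sum>r<m. int (t r) * a r i) mod int N)) {..<m}"
    for t :: "nat \<Rightarrow> nat"
  have "nat (z mod int N) < N" for z using N0 by (simp add: nat_less_iff)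
  then have gT: "g ` T \<subseteq> T" by (auto simp: g_def T_def)
  have inj: "inj_on g T"
  proof (rule inj_onI)
    fix t t' assume t: "t \<in> T" "t' \<in> T" "g t = g t'"
    have "t r = t' r" if "r < m" for r
    proof -
      have "int N dvd (\<Sum>r<m. (int (t r) - int (t' r)) * a r i)" if "i < m" for i
      proof -
        have "g t i = g t' i" using t(3) by simp
        then have "(\<Sum>r<m. int (t r) * a r i) mod int N = (\<Sum>r<m. int (t' r) * a r i) mod int N"
          using that N0 by (simp add: g_def nat_eq_iff)
        then show ?thesis by (simp add: mod_eq_dvd_iff left_diff_distrib sum_subtractf)
      qed
      then have "int N dvd int (t r) - int (t' r)"
        using N that by (intro prime_dvd_of_mat_kernel[where u = "\<lambda>r. int (t r) - int (t' r)"]) auto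
      then have "int (t r) mod int N = int (t' r) mod int N" by (simp add: mod_eq_dvd_iff)
      moreover have "t r < N" "t' r < N" using t that by (auto simp: T_def)
      ultimately show ?thesis by simp
    qed
    then show "t = t'" using t by (intro PiE_ext[of t "{..<m}" "\<lambda>_. {..<N}"]) (auto simp: T_def)
  qed
  have "(\<Sum>t\<in>T. \<Prod>i<m. w i (\<Sum>r<m. int (t r) * a r i)) = (\<Sum>t\<in>T. \<Prod>i<m. w i (int (g t i)))"
    using N0 by (intro sum.cong prod.cong) (auto simp: g_def w(2))
  also have "\<dots> = (\<Sum>s\<in>g ` T. \<Prod>i<m. w i (int (s i)))"
    by (simp add: sum.reindex[OF inj])
  also have "\<dots> \<le> (\<Sum>s\<in>T. \<Prod>i<m. w i (int (s i)))"
    using gT finT w(1) by (intro sum_mono2 prod_nonneg) auto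
  also have "\<dots> = (\<Prod>i<m. \<Sum>r<N. w i (int r))"
    unfolding T_def by (subst prod_sum_PiE) auto
  finally show ?thesis by (simp add: T_def)
qed

text \<open>Shifting by an integer multiple of \<open>pi\<close> changes at most the sign of the
  sine.\<close>

lemma sin_squared_mod_period:
  fixes z :: int
  assumes "N > 0"
  shows "(sin (pi * of_int (z mod int N) / real N))\<^sup>2 = (sin (pi * of_int z / real N))\<^sup>2"
proof -
  define x where "x = pi * of_int (z mod int N) / real N"
  define y where "y = pi * real_of_int (z div int N)"
  have "z = int N * (z div int N) + z mod int N" by simp
  then have "real_of_int z = real N * of_int (z div int N) + of_int (z mod int N)"
    by (metis of_int_add of_int_mult of_int_of_nat_eq)
  then have xy: "pi * of_int z / real N = x + y"
    using assms by (simp add: x_def y_def field_simps)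
  have "sin y = 0" unfolding y_def by (rule sin_npi_int)
  then have "(sin (x + y))\<^sup>2 = (sin x)\<^sup>2" by (simp add: sin_add power_mult_distrib cos_squared_eq)
  then show ?thesis by (simp add: xy x_def[symmetric])
qed

text \<open>The summand 1 absorbs the term \<open>r = 0\<close> of the one-dimensional sums, as \<open>1/N \<le> p\<^sup>-\<^sup>1\<^sup>/\<^sup>2\<close>; the other
  one is what remains of the integral of \<open>1 / (1 + s\<^sup>2 x\<^sup>2)\<close>.\<close>

definition block_constant :: "real \<Rightarrow> real" where
  "block_constant r = 1 + pi / (2 * sqrt (2 * r / (1 - r)\<^sup>2))"

text \<open>The lower bounds \<open>q0 i\<close> do not depend on the block, so every block obeys
  the same bound \<open>W\<close> and the AM-GM mean over blocks collapses to
  \<open>W\<close>.\<close>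

lemma prob_lattice_coset_blocks_le:
  fixes X :: "nat vec pmf" and q :: "nat \<Rightarrow> real"
    and a :: "nat \<Rightarrow> nat \<Rightarrow> int" and y :: "nat \<Rightarrow> int"
  assumes X: "indep_geometric_coords (p * m) X q" and p: "p \<ge> 2"
    and det: "\<And>k. k < p \<Longrightarrow> det (mat m m (\<lambda>(r, i). a r (k * m + i))) \<noteq> 0"
    and q0: "\<And>i. i < m \<Longrightarrow> 0 < q0 i" "\<And>k i. k < p \<Longrightarrow> i < m \<Longrightarrow> q0 i \<le> q (k * m + i)"
  shows "measure_pmf.prob X {x. \<forall>i<m. (\<Sum>j<p * m. a i j * (int (x $ j) - y j)) = 0}
    \<le> (\<Prod>i<m. block_constant (q0 i)) * real p powr (- real m / 2)"
proof -
  define D where "D k = det (mat m m (\<lambda>(r, i). a r (k * m + i)))" for k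
  \<comment> \<open>Exceeding every \<open>|D k|\<close> rules out division of the nonzero
    determinants; exceeding \<open>p\<close> later gives \<open>1 \<le> N / sqrt p\<close>.\<close>
  obtain N where N: "prime N" "p + (\<Sum>k<p. nat \<bar>D k\<bar>) < N" using bigger_prime by blast
  have N0: "N > 0" using N(1) by (rule prime_gt_0_nat)
  have ND: "\<not> int N dvd D k" if "k < p" for k
  proof
    assume "int N dvd D k"
    then have "int N \<le> \<bar>D k\<bar>" 
      using det[OF that] dvd_imp_le_int[of "D k" "int N"] by (simp add: D_def)
    moreover have "nat \<bar>D k\<bar> \<le> (\<Sum>k<p. nat \<bar>D k\<bar>)" using that by (intro member_le_sum) auto
    ultimately show False using N(2) by linarith
  qed
  have q1: "0 \<le> q j \<and> q j < 1" if "j < p * m" for j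
    using X that by (auto simp: indep_geometric_coords_def)
  have idx: "k * m + i < p * m" if "k < p" "i < m" for k i
  proof -
    have "k * m + i < Suc k * m" using that by simp
    also have "\<dots> \<le> p * m" using that by (intro mult_le_mono1) auto
    finally show ?thesis .
  qed
  have q0_1: "q0 i < 1" if "i < m" for i
    using q0(2)[of 0 i] q1[of i] idx[of 0 i] p that by auto
  define K where "K i = real p * 2 * q0 i / (1 - q0 i)\<^sup>2" for i
  have K: "K i > 0" if "i < m" for i
    using q0(1)[OF that] q0_1[OF that] p by (simp add: K_def)
  \<comment> \<open>The \<open>max 0\<close> makes \<open>w\<close> nonnegative for every
    \<open>i\<close>, while \<open>K i > 0\<close> is known only for \<open>i < m\<close>.\<close>
  define w where "w i z = 1 / (1 + max 0 (K i) * (sin (pi * of_int z / real N))\<^sup>2)" for i and z :: int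
  have w: "0 \<le> w i z" "w i (z mod int N) = w i z" for i z
    using N0 by (auto simp: w_def sin_squared_mod_period)
  define \<phi> where "\<phi> t j = norm (measure_pmf.expectation (geometric_pmf (1 - q j))
      (\<lambda>k. cis (2 * pi * of_int (\<Sum>i<m. int (t i) * a i j) / real N * real k)))"
    for t :: "nat \<Rightarrow> nat" and j
  define T where "T = PiE {..<m} (\<lambda>_. {..<N})"
  have \<phi>0: "0 \<le> \<phi> t j" for t j by (simp add: \<phi>_def)
  have \<phi>w: "\<phi> t (k * m + i) ^ p \<le> w i (\<Sum>r<m. int (t r) * a r (k * m + i))"
    if "k < p" "i < m" for t k i
  proof -
    have "max 0 (K i) = K i" using K[OF that(2)] by simp
    moreover have "\<phi> t (k * m + i) ^ p \<le> 1 / (1 + real p * 2 * q0 i / (1 - q0 i)\<^sup>2 *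
        (sin (2 * pi * of_int (\<Sum>r<m. int (t r) * a r (k * m + i)) / real N / 2))\<^sup>2)"
      unfolding \<phi>_def using q0(1)[OF that(2)] q0(2)[OF that] q1[OF idx[OF that]] p
      by (intro norm_geometric_characteristic_function_power_le) auto
    ultimately show ?thesis by (simp add: w_def K_def)
  qed
  define W where "W = (\<Prod>i<m. \<Sum>r<N. w i (int r))"
  have "real N ^ m * measure_pmf.prob X {x. \<forall>i<m. (\<Sum>j<p * m. a i j * (int (x $ j) - y j)) = 0}
      \<le> (\<Sum>t\<in>T. \<Prod>j<p * m. \<phi> t j)"
    unfolding T_def \<phi>_def by (rule prob_lattice_coset_le[OF X N0])
  also have "\<dots> \<le> (\<Sum>t\<in>T. (\<Sum>k<p. \<Prod>i<m. \<phi> t (k * m + i) ^ p) / real p)"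
  proof (rule sum_mono)
    fix t
    have "(\<Prod>k<p. \<Prod>i<m. \<phi> t (k * m + i)) \<le> (\<Sum>k<p. (\<Prod>i<m. \<phi> t (k * m + i)) ^ p) / real p"
      using p by (intro prod_le_mean_power prod_nonneg \<phi>0) auto
    then show "(\<Prod>j<p * m. \<phi> t j) \<le> (\<Sum>k<p. \<Prod>i<m. \<phi> t (k * m + i) ^ p) / real p"
      by (simp add: prod_lessThan_blocks prod_power_distrib)
  qed
  also have "\<dots> = (\<Sum>k<p. \<Sum>t\<in>T. \<Prod>i<m. \<phi> t (k * m + i) ^ p) / real p"
    unfolding sum_divide_distrib[symmetric] by (subst sum.swap) simp
  also have "\<dots> \<le> (\<Sum>k<p. W) / real p"
  proof (intro divide_right_mono sum_mono)
    fix k assume k: "k \<in> {..<p}"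
    have "(\<Sum>t\<in>T. \<Prod>i<m. \<phi> t (k * m + i) ^ p)
        \<le> (\<Sum>t\<in>T. \<Prod>i<m. w i (\<Sum>r<m. int (t r) * a r (k * m + i)))"
      using k \<phi>0 by (intro sum_mono prod_mono conjI \<phi>w zero_le_power) auto
    also have "\<dots> \<le> W"
      unfolding T_def W_def using N(1) ND[of k] k w
      by (intro sum_PiE_nonsingular_le[where a = "\<lambda>r i. a r (k * m + i)"]) (auto simp: D_def)
    finally show "(\<Sum>t\<in>T. \<Prod>i<m. \<phi> t (k * m + i) ^ p) \<le> W" .
  qed simp
  also have "\<dots> = W" using p by simp
  also have "W \<le> (\<Prod>i<m. real N * (block_constant (q0 i) * real p powr (- 1 / 2)))"
    unfolding W_def
  proof (intro prod_mono conjI sum_nonneg w)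
    fix i assume i: "i \<in> {..<m}"
    define c where "c = 2 * q0 i / (1 - q0 i)\<^sup>2"
    have c: "c > 0" using q0(1)[of i] q0_1[of i] i by (simp add: c_def)
    have Kc: "K i = real p * c" by (simp add: K_def c_def)
    have "(\<Sum>r<N. w i (int r)) = (\<Sum>r<N. 1 / (1 + K i * (sin (pi * real r / real N))\<^sup>2))"
      using K[of i] i by (simp add: w_def)
    also have "\<dots> \<le> 1 + real N * pi / (2 * sqrt (K i))"
      using K[of i] i N0 by (intro sum_inverse_sin_squared_le) auto
    also have "1 \<le> real N / sqrt (real p)"
    proof -
      have "sqrt (real p) \<le> real p" using p by (intro real_le_lsqrt) (auto simp: power2_eq_square)
      also have "\<dots> \<le> real N" using N(2) by simp
      finally show ?thesis using p by simp
    qed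
    also have "real N / sqrt (real p) + real N * pi / (2 * sqrt (K i))
        = real N * ((1 + pi / (2 * sqrt c)) * (1 / sqrt (real p)))"
      using c p by (simp add: Kc real_sqrt_mult field_simps)
    also have "1 / sqrt (real p) = real p powr (- 1 / 2)"
      using p by (simp add: powr_minus_divide powr_half_sqrt)
    finally show "(\<Sum>r<N. w i (int r)) \<le> real N * (block_constant (q0 i) * real p powr (- 1 / 2))"
      by (simp add: block_constant_def c_def)
  qed
  also have "\<dots> = real N ^ m * ((\<Prod>i<m. block_constant (q0 i)) * real p powr (- real m / 2))"
    using p by (simp add: prod.distrib powr_realpow[symmetric] powr_powr)
  finally show ?thesis using N0 by simp
qed

section \<open>Counting integer points\<close>

text \<open>The columns of the block form a distinct, linearly independent list, so the square block
  has full rank.\<close>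

lemma det_block_nonzero:
  fixes A :: "real mat"
  assumes A: "A \<in> carrier_mat m n" and J: "k * m + m \<le> n"
    and ind: "indep_columns A {k * m..<(k + 1) * m}"
  shows "det (mat m m (\<lambda>(r, i). A $$ (r, k * m + i))) \<noteq> 0"
proof -
  interpret vec_space "TYPE(real)" m .
  define M where "M = mat m m (\<lambda>(r, i). A $$ (r, k * m + i))"
  have M: "M \<in> carrier_mat m m" by (simp add: M_def)
  have "cols M = map (\<lambda>i. col A (k * m + i)) [0..<m]"
    using A J by (auto simp: cols_def M_def intro!: nth_equalityI)
  also have "\<dots> = map (col A) (map (\<lambda>i. i + k * m) [0..<m])" by (simp add: add.commute)
  also have "map (\<lambda>i. i + k * m) [0..<m] = [k * m..<(k + 1) * m]"
    by (simp add: map_add_upt add.commute)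
  finally have c: "cols M = map (col A) [k * m..<(k + 1) * m]" .
  have "distinct (cols M)" "lin_indpt (set (cols M))"
    using ind A unfolding c indep_columns_def by (auto simp: distinct_map)
  then have "rank M = m" using M by (intro lin_indpt_full_rank)
  then show ?thesis using det_rank_iff[OF M] by (simp add: M_def)
qed

text \<open>Each integer point carries mass at least \<open>exp (- h)\<close>, and distinct points
  are disjoint atoms inside one event of probability at most \<open>B\<close>.\<close>

lemma integer_points_bound:
  fixes A :: "real mat" and b :: "real vec" and X :: "nat vec pmf" and q :: "nat \<Rightarrow> real"
  assumes A: "A \<in> carrier_mat m n" and int: "elements_mat A \<subseteq> \<int>" and mn: "m < n"
    and max: "max_entropy_vec A b X" and X: "indep_geometric_coords n X q"
    and n: "n = p * m"
    and ind: "\<And>k. k < p \<Longrightarrow> indep_columns A {k * m..<(k + 1) * m}"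
    and q0: "\<And>i. i < m \<Longrightarrow> 0 < qvee m p q $ i"
  shows "finite (polyhedron_std A b \<inter> integer_vecs n) \<and>
    real (card (polyhedron_std A b \<inter> integer_vecs n)) \<le> exp (enn2real (pmf_entropy X)) *
      ((\<Prod>i<m. block_constant (qvee m p q $ i)) * real p powr (- real m / 2))"
proof -
  define S where "S = polyhedron_std A b \<inter> integer_vecs n"
  define h where "h = enn2real (pmf_entropy X)"
  define B where "B = (\<Prod>i<m. block_constant (qvee m p q $ i)) * real p powr (- real m / 2)"
  have p: "p \<ge> 2"
  proof (rule ccontr)
    assume "\<not> p \<ge> 2"
    then have "p = 0 \<or> p = 1" by auto
    then show False using mn n by auto
  qed
  have supp: "set_pmf X \<subseteq> carrier_vec n"
    using max A by (auto simp: max_entropy_vec_def mean_constrained_def)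
  have qmin: "qvee m p q $ i \<le> q (k * m + i)" if "k < p" "i < m" for k i
    using that by (auto simp: qvee_def intro!: Min_le)
  have qpos: "0 < q j" if "j < n" for j
  proof -
    have "m > 0" using that n by (cases m) auto
    then have "j div m < p" "j mod m < m" using that n by (auto simp: less_mult_imp_div_less)
    from q0[OF this(2)] qmin[OF this] show ?thesis by simp
  qed
  have q1: "q j < 1" if "j < n" for j using X that by (simp add: indep_geometric_coords_def)
  define a where "a i j = \<lfloor>A $$ (i, j)\<rfloor>" for i j
  have a: "of_int (a i j) = A $$ (i, j)" if "i < m" "j < n" for i j
  proof -
    have "A $$ (i, j) \<in> elements_mat A" using A that by (intro elements_matI[of A m n i j]) auto
    then have "A $$ (i, j) \<in> \<int>" using int by blast
    then show ?thesis by (simp add: a_def)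
  qed
  have det: "det (mat m m (\<lambda>(r, i). a r (k * m + i))) \<noteq> 0" if "k < p" for k
  proof -
    have "Suc k * m \<le> p * m" using that by (intro mult_le_mono1) auto
    then have le: "k * m + m \<le> n" by (simp add: n add.commute)
    have "map_mat real_of_int (mat m m (\<lambda>(r, i). a r (k * m + i)))
        = mat m m (\<lambda>(r, i). A $$ (r, k * m + i))"
      using le by (intro eq_matI) (auto intro!: a)
    then have "real_of_int (det (mat m m (\<lambda>(r, i). a r (k * m + i))))
        = det (mat m m (\<lambda>(r, i). A $$ (r, k * m + i)))"
      by (simp flip: of_int_hom.hom_det)
    with det_block_nonzero[OF A le ind[OF that]] show ?thesis by auto
  qed
  \<comment> \<open>Passes from real integer points to the type of the values of \<open>X\<close>;
    \<open>map_vec real\<close> inverts it on \<open>S\<close>, which gives injectivity.\<close>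
  define g where "g x = map_vec (\<lambda>r::real. nat \<lfloor>r\<rfloor>) x" for x
  have g: "map_vec real (g x) = x" "g x \<in> carrier_vec n" if "x \<in> S" for x
  proof -
    have "x \<in> integer_vecs n" "0\<^sub>v (dim_col A) \<le> x"
      using that by (simp_all add: S_def polyhedron_std_def)
    then have x: "x \<in> carrier_vec n" "\<And>j. j < n \<Longrightarrow> x $ j \<in> \<int>" "\<And>j. j < n \<Longrightarrow> 0 \<le> x $ j"
      using A by (auto simp: integer_vecs_def less_eq_vec_def)
    then show "g x \<in> carrier_vec n" by (simp add: g_def)
    show "map_vec real (g x) = x"
    proof (rule eq_vecI)
      fix j assume "j < dim_vec x"
      then have "j < n" using x(1) by auto
      then show "map_vec real (g x) $ j = x $ j"
        using x(1) x(2)[of j] x(3)[of j] by (auto simp: g_def elim!: Ints_cases)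
    qed (simp add: g_def)
  qed
  have bound: "real (card F) \<le> exp h * B" if F: "F \<subseteq> S" "finite F" for F
  proof (cases "F = {}")
    case True
    have "0 \<le> B"
      unfolding B_def block_constant_def using q0
      by (intro mult_nonneg_nonneg prod_nonneg add_nonneg_nonneg divide_nonneg_nonneg
          real_sqrt_ge_zero) (auto intro: less_imp_le)
    then show ?thesis using True by simp
  next
    case False
    then obtain x0 where x0: "x0 \<in> S" using F by auto
    \<comment> \<open>The point \<open>x0\<close> of \<open>F\<close> serves as reference solution,
      so the event \<open>A X = b\<close> becomes a system of integer equations although
      \<open>b\<close> is real.\<close>
    define E where "E = {x. \<forall>i<m. (\<Sum>j<p * m. a i j * (int (x $ j) - int (g x0 $ j))) = 0}"
    have row: "(\<Sum>j<n. of_int (a i j) * real (g x $ j)) = b $ i" if "x \<in> S" "i < m" for x i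
    proof -
      have "(A *\<^sub>v map_vec real (g x)) $ i = b $ i"
        using that g[of x] by (auto simp: S_def polyhedron_std_def)
      moreover have "(A *\<^sub>v map_vec real (g x)) $ i = (\<Sum>j<n. of_int (a i j) * real (g x $ j))"
        using A g(2)[OF that(1)] that(2) by (auto simp: scalar_prod_def a atLeast0LessThan)
      ultimately show ?thesis by simp
    qed
    have gE: "g ` F \<subseteq> E"
    proof -
      have "(\<Sum>j<p * m. a i j * (int (g x $ j) - int (g x0 $ j))) = 0" if "x \<in> S" "i < m" for x i
      proof -
        have "real_of_int (\<Sum>j<n. a i j * (int (g x $ j) - int (g x0 $ j))) = b $ i - b $ i"
          using row[OF that] row[OF x0 that(2)] by (simp add: sum_subtractf right_diff_distrib)
        then have "real_of_int (\<Sum>j<n. a i j * (int (g x $ j) - int (g x0 $ j))) = of_int 0" by simp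
        then show ?thesis unfolding n of_int_eq_iff .
      qed
      then show ?thesis using F by (auto simp: E_def)
    qed
    have inj: "inj_on g F" using F g(1) by (intro inj_on_inverseI[where g = "map_vec real"]) auto
    have "exp (- h) \<le> pmf X (g x)" if "x \<in> F" for x
    proof -
      have xS: "x \<in> S" using that F by auto
      have "0 < pmf X (g x)"
        using pmf_indep_geometric_coords[OF X supp g(2)[OF xS]] qpos q1 mn
        by (auto intro!: prod_pos mult_pos_pos)
      then show ?thesis
        unfolding h_def using A g[OF xS] xS mn
        by (intro max_entropy_pmf_ge[OF max]
            integrable_ln_pmf_indep_geometric_coords[OF X supp qpos])
          (auto simp: S_def polyhedron_std_def)
    qed
    then have "(\<Sum>x\<in>F. exp (- h)) \<le> (\<Sum>x\<in>F. pmf X (g x))" by (rule sum_mono)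
    also have "\<dots> = measure_pmf.prob X (g ` F)"
      using F inj by (simp add: measure_measure_pmf_finite sum.reindex)
    also have "\<dots> \<le> measure_pmf.prob X E" using gE by (intro measure_pmf.finite_measure_mono) auto
    also have "\<dots> \<le> B"
      unfolding E_def B_def using X p det q0 qmin
      by (intro prob_lattice_coset_blocks_le) (auto simp: n)
    finally have "real (card F) * exp (- h) \<le> B" by simp
    then show ?thesis by (simp add: exp_minus field_simps)
  qed
  \<comment> \<open>A bound uniform over finite subsets yields finiteness of \<open>S\<close> as
    well as its size.\<close>
  have "finite S \<and> card S \<le> nat \<lfloor>exp h * B\<rfloor>"
    by (rule finite_if_finite_subsets_card_bdd) (use bound in \<open>auto simp: le_nat_floor\<close>)
  then show ?thesis using bound[of S] by (simp add: S_def h_def B_def)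
qed

theorem theorem2:
  shows "\<exists>C C' :: real vec \<Rightarrow> real. (\<forall>v. C' v < 1) \<and>
    (\<forall>(m::nat) (n::nat) (p::nat) (A::real mat) (b::real vec) (X::nat vec pmf) (q::nat \<Rightarrow> real).
       A \<in> carrier_mat m n \<longrightarrow> elements_mat A \<subseteq> \<int> \<longrightarrow> m < n \<longrightarrow> vec_space.rank m A = m \<longrightarrow>
       b \<in> carrier_vec m \<longrightarrow>
       max_entropy_vec A b X \<longrightarrow> indep_geometric_coords n X q \<longrightarrow>
       n = p * m \<longrightarrow>
       (\<forall>k<p. indep_columns A {k * m..<(k + 1) * m}) \<longrightarrow>
       (\<forall>j<n. 0 < scalar_prod (col A j) b) \<longrightarrow>
       (\<forall>i<m. 0 < qvee m p q $ i) \<longrightarrow>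
       finite (polyhedron_std A b \<inter> integer_vecs n) \<and>
       real (card (polyhedron_std A b \<inter> integer_vecs n))
         \<le> exp (enn2real (pmf_entropy X)) *
            (C (qvee m p q) * real p powr (- real m / 2) + C' (qvee m p q) ^ p))"
proof (intro exI conjI allI impI)
  fix m n p A b X q
  assume *: "A \<in> carrier_mat m n" "elements_mat A \<subseteq> \<int>" "m < n"
    "max_entropy_vec A b X" "indep_geometric_coords n X q" "n = p * m"
    "\<forall>k<p. indep_columns A {k * m..<(k + 1) * m}" "\<forall>i<m. 0 < qvee m p q $ i"
  \<comment> \<open>The number of factors is read off \<open>dim_vec v\<close>, so \<open>?C\<close>
    depends on the vector of minima alone.\<close>
  let ?C = "\<lambda>v :: real vec. \<Prod>i<dim_vec v. block_constant (v $ i)"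
  let ?C' = "\<lambda>_ :: real vec. 0 :: real"
  \<comment> \<open>Needed because \<open>0 ^ 0 = 1\<close>: only for positive \<open>p\<close> does
    the second term vanish.\<close>
  have "p > 0" using *(3,6) by (cases p) auto
  then have "?C (qvee m p q) * real p powr (- real m / 2) + ?C' (qvee m p q) ^ p
      = (\<Prod>i<m. block_constant (qvee m p q $ i)) * real p powr (- real m / 2)"
    by (simp add: qvee_def)
  then show "finite (polyhedron_std A b \<inter> integer_vecs n)"
    "real (card (polyhedron_std A b \<inter> integer_vecs n)) \<le> exp (enn2real (pmf_entropy X)) *
      (?C (qvee m p q) * real p powr (- real m / 2) + ?C' (qvee m p q) ^ p)"
    using integer_points_bound[OF *(1-6)] *(7,8) by auto
qed simp

end
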